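(* Fix $k\geq 2$ and suppose that $\Gamma$ is a computable embedding witnessing $\{\omega\cdot k,\ \omega^\star\cdot k\}\leq_c\{\mathcal{D}_0,\mathcal{D}_1\}$, where $\mathcal{D}_0$ is a linear order without infinite descending chains and $\mathcal{D}_1$ is an infinite linear order without infinite ascending chains. Then $\mathcal{D}_0$ contains a suborder isomorphic to $\omega\cdot k$ and $\mathcal{D}_1$ contains a suborder isomorphic to $\omega^\star\cdot k$.
   Context: Structures have domains contained in $\omega$ and are in the language of linear orders; a class is identified with all isomorphic copies of its members. An enumeration operator $\Gamma$ is a c.e. set of pairs $(\alpha,\varphi)$ with $\alpha$ a finite set of basic sentences with constants from $\omega$ and $\varphi$ a basic sentence with constants from $\omega$; $\Gamma(\mathcal{S})=\{\varphi:(\alpha,\varphi)\in\Gamma,\ \alpha\subseteq D(\mathcal{S})\}$, $D(\mathcal{S})$ the atomic diagram. $\Gamma$ witnesses $\{\mathcal{A},\mathcal{B}\}\leq_c\{\mathcal{C},\mathcal{D}\}$ (for non-isomorphic $\mathcal{A},\mathcal{B}$) if for every copy $\hat{\mathcal{A}}$ of $\mathcal{A}$, $\Gamma(\hat{\mathcal{A}})$ is the atomic diagram of a copy of $\mathcal{C}$, and for every copy $\hat{\mathcal{B}}$ of $\mathcal{B}$, $\Gamma(\hat{\mathcal{B}})$ is the atomic diagram of a copy of $\mathcal{D}$. $\omega\cdot k$ is the order type of $k$ copies of $\omega$ placed one after another; $\omega^\star\cdot k$ is that of $k$ copies of $\omega^\star$ (the reverse of $\omega$). *)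

theory Defs
  imports Main "HOL-Library.Nat_Bijection"
begin

section \<open>Computably enumerable sets of natural numbers\<close>

datatype recf = Zero | Succ | Proj nat | Comp recf "recf list" | PrimRec recf recf | Mu recf

text \<open>
  \<open>computes f xs y\<close>: the partial recursive function denoted by \<open>f\<close> is defined on the
  argument tuple \<open>xs\<close> and has value \<open>y\<close> there. A term may be applied at several arities. The
  recursion and search variable is the first argument.
\<close>

inductive computes :: "recf \<Rightarrow> nat list \<Rightarrow> nat \<Rightarrow> bool" where
  zero: "computes Zero xs 0"
| succ: "computes Succ [x] (Suc x)"
| proj: "i < length xs \<Longrightarrow> computes (Proj i) xs (xs ! i)"
| comp: "length ys = length gs \<Longrightarrow> (\<And>i. i < length gs \<Longrightarrow> computes (gs ! i) xs (ys ! i)) \<Longrightarrow>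
    computes f ys z \<Longrightarrow> computes (Comp f gs) xs z"
| prim_0: "computes f xs y \<Longrightarrow> computes (PrimRec f g) (0 # xs) y"
| prim_Suc: "computes (PrimRec f g) (n # xs) y \<Longrightarrow> computes g (n # y # xs) z \<Longrightarrow>
    computes (PrimRec f g) (Suc n # xs) z"
| mu: "computes f (n # xs) 0 \<Longrightarrow> (\<And>m. m < n \<Longrightarrow> \<exists>y>0. computes f (m # xs) y) \<Longrightarrow>
    computes (Mu f) xs n"

definition ce :: "nat set \<Rightarrow> bool" where
  "ce A \<longleftrightarrow> (\<exists>f. A = {n. \<exists>y. computes f [n] y})"


section \<open>Structures and atomic diagrams\<close>

text \<open>
  A structure in the language of linear orders with domain contained in \<open>\<omega>\<close> is represented by
  its reflexive order relation \<open>S :: nat rel\<close>; the domain is \<open>Field S\<close>. Basic sentences are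
  atomic and negated atomic sentences, equality included.
\<close>

datatype basic = Le nat nat | NotLe nat nat | Eq nat nat | NotEq nat nat

definition diagram :: "nat rel \<Rightarrow> basic set" where
  "diagram S =
     {Le a b | a b. a \<in> Field S \<and> b \<in> Field S \<and> (a, b) \<in> S} \<union>
     {NotLe a b | a b. a \<in> Field S \<and> b \<in> Field S \<and> (a, b) \<notin> S} \<union>
     {Eq a b | a b. a \<in> Field S \<and> b \<in> Field S \<and> a = b} \<union>
     {NotEq a b | a b. a \<in> Field S \<and> b \<in> Field S \<and> a \<noteq> b}"

text \<open>Isomorphism, possibly between orders on different carrier types.\<close>

definition isomorphic :: "'a rel \<Rightarrow> 'b rel \<Rightarrow> bool" where
  "isomorphic A B \<longleftrightarrow> (\<exists>f. iso A B f)"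


section \<open>Enumeration operators and computable embeddings\<close>

fun basic_code :: "basic \<Rightarrow> nat" where
  "basic_code (Le a b) = prod_encode (0, prod_encode (a, b))"
| "basic_code (NotLe a b) = prod_encode (1, prod_encode (a, b))"
| "basic_code (Eq a b) = prod_encode (2, prod_encode (a, b))"
| "basic_code (NotEq a b) = prod_encode (3, prod_encode (a, b))"

text \<open>A finite set of basic sentences is coded by the canonical index of its set of codes.\<close>

definition axiom_code :: "basic set \<times> basic \<Rightarrow> nat" where
  "axiom_code = (\<lambda>(\<alpha>, \<phi>). prod_encode (set_encode (basic_code ` \<alpha>), basic_code \<phi>))"

lemma inj_basic_code: "inj basic_code"
proof (rule injI)
  fix x y assume "basic_code x = basic_code y"
  then show "x = y" by (cases x; cases y; simp)
qed

lemma inj_on_axiom_code: "inj_on axiom_code {(\<alpha>, \<phi>). finite \<alpha>}"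
proof (rule inj_onI, clarify)
  fix \<alpha> \<beta> \<phi> \<psi> assume fin: "finite \<alpha>" "finite \<beta>" and "axiom_code (\<alpha>, \<phi>) = axiom_code (\<beta>, \<psi>)"
  then have "set_encode (basic_code ` \<alpha>) = set_encode (basic_code ` \<beta>)"
    and "basic_code \<phi> = basic_code \<psi>"
    by (simp_all add: axiom_code_def)
  with fin show "\<alpha> = \<beta> \<and> \<phi> = \<psi>"
    by (auto simp: set_encode_eq inj_image_eq_iff[OF inj_basic_code] dest: injD[OF inj_basic_code])
qed

definition enumeration_operator :: "(basic set \<times> basic) set \<Rightarrow> bool" where
  "enumeration_operator \<Gamma> \<longleftrightarrow> (\<forall>(\<alpha>, \<phi>) \<in> \<Gamma>. finite \<alpha>) \<and> ce (axiom_code ` \<Gamma>)"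

definition apply_op :: "(basic set \<times> basic) set \<Rightarrow> nat rel \<Rightarrow> basic set" where
  "apply_op \<Gamma> S = {\<phi>. \<exists>\<alpha>. (\<alpha>, \<phi>) \<in> \<Gamma> \<and> \<alpha> \<subseteq> diagram S}"

text \<open>
  \<open>A\<close>, \<open>B\<close>, \<open>C\<close>, \<open>D\<close> only matter up to isomorphism, so they may live on any type; their copies
  have domains contained in \<open>\<omega>\<close>.
\<close>

definition witnesses_embedding ::
    "(basic set \<times> basic) set \<Rightarrow> 'a rel \<Rightarrow> 'b rel \<Rightarrow> 'c rel \<Rightarrow> 'd rel \<Rightarrow> bool" where
  "witnesses_embedding \<Gamma> A B C D \<longleftrightarrow>
     enumeration_operator \<Gamma> \<and> \<not> isomorphic A B \<and>
     (\<forall>S :: nat rel. isomorphic S A \<longrightarrow>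
        (\<exists>T :: nat rel. isomorphic T C \<and> apply_op \<Gamma> S = diagram T)) \<and>
     (\<forall>S :: nat rel. isomorphic S B \<longrightarrow>
        (\<exists>T :: nat rel. isomorphic T D \<and> apply_op \<Gamma> S = diagram T))"


section \<open>Order types and chains\<close>

definition copies :: "nat \<Rightarrow> 'a rel \<Rightarrow> (nat \<times> 'a) rel" where
  "copies k r = {((i, x), (j, y)). i < k \<and> j < k \<and> x \<in> Field r \<and> y \<in> Field r \<and>
     (i < j \<or> i = j \<and> (x, y) \<in> r)}"

definition omega_times :: "nat \<Rightarrow> (nat \<times> nat) rel" where
  "omega_times k = copies k natLeq"

definition omega_star_times :: "nat \<Rightarrow> (nat \<times> nat) rel" where
  "omega_star_times k = copies k (natLeq\<inverse>)"

definition has_infinite_descending_chain :: "'a rel \<Rightarrow> bool" where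
  "has_infinite_descending_chain r \<longleftrightarrow> (\<exists>f :: nat \<Rightarrow> 'a. \<forall>i. (f (Suc i), f i) \<in> r \<and> f (Suc i) \<noteq> f i)"

definition has_infinite_ascending_chain :: "'a rel \<Rightarrow> bool" where
  "has_infinite_ascending_chain r \<longleftrightarrow> (\<exists>f :: nat \<Rightarrow> 'a. \<forall>i. (f i, f (Suc i)) \<in> r \<and> f i \<noteq> f (Suc i))"

definition has_suborder_isomorphic_to :: "'a rel \<Rightarrow> 'b rel \<Rightarrow> bool" where
  "has_suborder_isomorphic_to r s \<longleftrightarrow> (\<exists>X \<subseteq> Field r. isomorphic (Restr r X) s)"

end

theory Submission
  imports Defs "HOL-Library.Ramsey" "HOL-Library.Countable"
begin

text \<open>
  The proof uses \<open>\<Gamma>\<close> only through monotonicity and compactness. If a finite order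
  \<open>\<alpha>\<close> already makes \<open>\<Gamma>\<close> output the elements \<open>x\<close> and \<open>y\<close>, then all copies extending \<open>\<alpha>\<close>
  give \<open>x\<close> and \<open>y\<close> the same order. Choose finite orders \<open>b\<^sub>i\<close> with pairwise disjoint domains
  that output pairwise distinct elements \<open>z\<^sub>i\<close>. By Ramsey's theorem we may assume that, for
  \<open>i < j\<close>, the order of \<open>z\<^sub>i\<close> and \<open>z\<^sub>j\<close> forced by \<open>b\<^sub>i + b\<^sub>j\<close> does not depend on \<open>i, j\<close>, and
  likewise for \<open>b\<^sub>j + b\<^sub>i\<close>. As \<open>D\<^sub>0\<close> has no descending and \<open>D\<^sub>1\<close> no ascending chain, stringing
  the blocks together in type \<open>\<omega>\<close> and in type \<open>\<omega>\<^sup>\<star>\<close> shows that the earlier block always outputs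
  the smaller element. Hence arranging the blocks in type \<open>\<omega> \<cdot> k\<close> or \<open>\<omega>\<^sup>\<star> \<cdot> k\<close> produces outputs
  of the same order type.
\<close>

section \<open>Diagrams of restrictions; monotonicity and compactness of enumeration
  operators\<close>

lemma diagram_iff [simp]:
  "Le a b \<in> diagram S \<longleftrightarrow> a \<in> Field S \<and> b \<in> Field S \<and> (a, b) \<in> S"
  "Eq a b \<in> diagram S \<longleftrightarrow> a \<in> Field S \<and> a = b"
  "NotLe a b \<in> diagram S \<longleftrightarrow> a \<in> Field S \<and> b \<in> Field S \<and> (a, b) \<notin> S"
  "NotEq a b \<in> diagram S \<longleftrightarrow> a \<in> Field S \<and> b \<in> Field S \<and> a \<noteq> b"
  by (auto simp: diagram_def)

lemma Field_Restr_Linear_order: "Linear_order S \<Longrightarrow> Field (Restr S X) = X \<inter> Field S"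
  by (auto simp: order_on_defs Refl_Field_Restr)

lemma diagram_Restr_mono:
  assumes "Linear_order S" shows "diagram (Restr S X) \<subseteq> diagram S"
proof
  fix \<phi> assume "\<phi> \<in> diagram (Restr S X)"
  then show "\<phi> \<in> diagram S"
    using Field_Restr_Linear_order[OF assms] by (cases \<phi>) auto
qed

lemma apply_op_mono: "diagram S \<subseteq> diagram S' \<Longrightarrow> apply_op \<Gamma> S \<subseteq> apply_op \<Gamma> S'"
  unfolding apply_op_def by blast

lemma apply_op_Restr_mono: "Linear_order S \<Longrightarrow> apply_op \<Gamma> (Restr S X) \<subseteq> apply_op \<Gamma> S"
  by (intro apply_op_mono diagram_Restr_mono)

lemma apply_op_Restr_le:
  assumes "Linear_order S" "X \<subseteq> Y"
  shows "apply_op \<Gamma> (Restr S X) \<subseteq> apply_op \<Gamma> (Restr S Y)"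
proof -
  have "Restr (Restr S Y) X = Restr S X" using assms(2) by blast
  then show ?thesis using apply_op_Restr_mono[OF Linear_order_Restr[OF assms(1)]] by metis
qed

primrec constants :: "basic \<Rightarrow> nat set" where
  "constants (Le a b) = {a, b}"
| "constants (NotLe a b) = {a, b}"
| "constants (Eq a b) = {a, b}"
| "constants (NotEq a b) = {a, b}"

lemma finite_constants [simp]: "finite (constants \<phi>)"
  by (cases \<phi>) auto

text \<open>A single axiom of \<open>\<Gamma>\<close> enumerates \<open>\<phi>\<close>, and its
  finite premise mentions only finitely many constants; these form \<open>X\<close>.\<close>

lemma apply_op_compact:
  assumes "\<phi> \<in> apply_op \<Gamma> S" "enumeration_operator \<Gamma>" "Linear_order S"
  obtains X where "finite X" "X \<subseteq> Field S" "\<phi> \<in> apply_op \<Gamma> (Restr S X)"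
proof -
  obtain \<alpha> where \<alpha>: "(\<alpha>, \<phi>) \<in> \<Gamma>" "\<alpha> \<subseteq> diagram S" "finite \<alpha>"
    using assms(1,2) unfolding apply_op_def enumeration_operator_def by blast
  define X where "X = (\<Union>\<psi>\<in>\<alpha>. constants \<psi>)"
  have F: "Field (Restr S X) = X \<inter> Field S"
    by (rule Field_Restr_Linear_order[OF assms(3)])
  have "constants \<psi> \<subseteq> Field S" if "\<psi> \<in> diagram S" for \<psi>
    using that by (cases \<psi>) auto
  then have "X \<subseteq> Field S" unfolding X_def using \<alpha>(2) by blast
  moreover have "\<alpha> \<subseteq> diagram (Restr S X)"
  proof
    fix \<psi> assume "\<psi> \<in> \<alpha>"
    then have "constants \<psi> \<subseteq> X" "\<psi> \<in> diagram S" unfolding X_def using \<alpha>(2) by auto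
    then show "\<psi> \<in> diagram (Restr S X)" by (cases \<psi>) (simp_all add: F)
  qed
  moreover have "finite X" unfolding X_def using \<alpha>(3) by simp
  ultimately show ?thesis using that \<alpha>(1) unfolding apply_op_def by blast
qed

section \<open>The two source order types\<close>

lemma natLeq_iff: "(x, y) \<in> natLeq \<longleftrightarrow> x \<le> y"
  by (simp add: natLeq_def)

lemma omega_times_iff [simp]:
  "((c, x), (d, y)) \<in> omega_times k \<longleftrightarrow> c < k \<and> d < k \<and> (c < d \<or> c = d \<and> x \<le> y)"
  by (auto simp: omega_times_def copies_def Field_natLeq natLeq_iff)

lemma omega_star_times_iff [simp]:
  "((c, x), (d, y)) \<in> omega_star_times k \<longleftrightarrow> c < k \<and> d < k \<and> (c < d \<or> c = d \<and> y \<le> x)"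
  by (auto simp: omega_star_times_def copies_def Field_natLeq natLeq_iff)

lemma Field_omega_times [simp]: "Field (omega_times k) = {..<k} \<times> UNIV"
proof -
  have "p \<in> Field (omega_times k)" if "fst p < k" for p
    using that by (intro FieldI1[of _ p]) (cases p, simp)
  moreover have "fst p < k" if "p \<in> Field (omega_times k)" for p
    using that by (cases p) (auto simp: Field_def)
  ultimately show ?thesis by auto
qed

lemma Field_omega_star_times [simp]: "Field (omega_star_times k) = {..<k} \<times> UNIV"
proof -
  have "p \<in> Field (omega_star_times k)" if "fst p < k" for p
    using that by (intro FieldI1[of _ p]) (cases p, simp)
  moreover have "fst p < k" if "p \<in> Field (omega_star_times k)" for p
    using that by (cases p) (auto simp: Field_def)
  ultimately show ?thesis by auto
qed

lemma Linear_order_omega_times: "Linear_order (omega_times k)"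
  unfolding order_on_defs refl_on_def trans_def antisym_def total_on_def by auto

lemma Linear_order_omega_star_times: "Linear_order (omega_star_times k)"
  unfolding order_on_defs refl_on_def trans_def antisym_def total_on_def by auto

section \<open>Copies on the natural numbers with a prescribed part\<close>

lemma Linear_order_isomorphic:
  assumes "isomorphic S K" "Linear_order K" shows "Linear_order S"
proof -
  obtain f where f: "bij_betw f (Field S) (Field K)"
    "\<And>a b. a \<in> Field S \<Longrightarrow> b \<in> Field S \<Longrightarrow> (a, b) \<in> S \<longleftrightarrow> (f a, f b) \<in> K"
    using assms(1) unfolding isomorphic_def iso_iff2 by blast
  have fF: "f a \<in> Field K" if "a \<in> Field S" for a using f(1) that by (auto simp: bij_betw_def)
  have inj: "a = b" if "a \<in> Field S" "b \<in> Field S" "f a = f b" for a b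
    using f(1) that by (auto simp: bij_betw_def inj_on_def)
  have K: "refl_on (Field K) K" "trans K" "antisym K" "total_on (Field K) K"
    using assms(2) by (auto simp: order_on_defs)
  have "refl_on (Field S) S"
    using K(1) f(2) fF unfolding refl_on_def by (auto intro: FieldI1 FieldI2)
  moreover have "trans S"
    by (rule transI) (metis FieldI1 FieldI2 K(2) f(2) transD)
  moreover have "antisym S"
    by (rule antisymI) (metis FieldI1 FieldI2 K(3) f(2) inj antisymD)
  moreover have "total_on (Field S) S"
    using K(4) f(2) fF inj unfolding total_on_def by metis
  ultimately show ?thesis by (auto simp: order_on_defs Field_def)
qed

text \<open>This is the source of all copies built below: \<open>g\<close> says which positions of
  \<open>K\<close> the elements of \<open>Y\<close> occupy, and the remaining positions are filled
  with fresh numbers from the reserve \<open>W\<close>.\<close>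

lemma extend_embedding:
  fixes g :: "nat \<Rightarrow> 'a::countable"
  assumes g: "inj_on g Y" "g ` Y \<subseteq> Field K" and W: "infinite W" "W \<inter> Y = {}"
  obtains S f where "iso S K f" "Y \<subseteq> Field S" "Field S \<subseteq> Y \<union> W" "\<And>a. a \<in> Y \<Longrightarrow> f a = g a"
proof -
  \<comment> \<open>\<open>h\<close> names every position by a number: the element of
    \<open>Y\<close> sitting there, or else the element of \<open>W\<close> indexed by the code of
    the position. It is injective on the whole type, so \<open>inv h\<close> undoes it
    everywhere.\<close>
  define h where "h p = (if p \<in> g ` Y then inv_into Y g p else enumerate W (to_nat p))" for p
  have eW: "enumerate W n \<in> W" for n by (simp add: W(1) enumerate_in_set)
  have einj: "enumerate W m = enumerate W n \<longleftrightarrow> m = n" for m n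
    using strict_mono_enumerate[OF W(1)] by (simp add: strict_mono_eq)
  have hg: "h (g a) = a" if "a \<in> Y" for a using that g(1) by (simp add: h_def)
  have hW: "h p \<in> W" if "p \<notin> g ` Y" for p using that eW by (simp add: h_def)
  have inj: "inj h"
  proof (rule injI)
    fix p q assume eq: "h p = h q"
    show "p = q"
    proof (cases "p \<in> g ` Y"; cases "q \<in> g ` Y")
      assume "p \<in> g ` Y" "q \<in> g ` Y" then show ?thesis using eq hg by auto
    next
      assume "p \<in> g ` Y" "q \<notin> g ` Y" then show ?thesis using eq hg hW W(2) by fastforce
    next
      assume "p \<notin> g ` Y" "q \<in> g ` Y" then show ?thesis using eq hg hW W(2) by fastforce
    next
      assume "p \<notin> g ` Y" "q \<notin> g ` Y" then show ?thesis using eq einj by (simp add: h_def)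
    qed
  qed
  define S where "S = map_prod h h ` K"
  have SK: "(h p, h q) \<in> S \<longleftrightarrow> (p, q) \<in> K" for p q
    using inj by (auto simp: S_def inj_def)
  have FS: "Field S = h ` Field K" by (force simp: S_def Field_def)
  define f where "f = inv h"
  have fh: "f (h p) = p" for p using inj by (simp add: f_def)
  have "bij_betw f (Field S) (Field K)"
    unfolding FS by (rule bij_betwI[where g = h]) (auto simp: fh)
  then have "iso S K f" unfolding iso_iff2 FS by (auto simp: fh SK)
  moreover have "Y \<subseteq> Field S"
  proof
    fix a assume "a \<in> Y"
    then have "g a \<in> Field K" "a = h (g a)" using hg g(2) by auto
    then show "a \<in> Field S" unfolding FS by blast
  qed
  moreover have "Field S \<subseteq> Y \<union> W"
  proof
    fix a assume "a \<in> Field S"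
    then obtain p where "a = h p" unfolding FS by blast
    then show "a \<in> Y \<union> W" using hg hW by (cases "p \<in> g ` Y") auto
  qed
  moreover have "f a = g a" if "a \<in> Y" for a using fh[of "g a"] hg[OF that] by simp
  ultimately show ?thesis using that by blast
qed

text \<open>The rank counts strict predecessors. It is strictly increasing and bounded by the
  cardinality, so counting makes it onto.\<close>

lemma finite_Linear_order_rank:
  assumes "Linear_order r" "finite (Field r)"
  obtains q where "bij_betw q (Field r) {..<card (Field r)}"
    "\<And>a b. a \<in> Field r \<Longrightarrow> b \<in> Field r \<Longrightarrow> (a, b) \<in> r \<longleftrightarrow> q a \<le> q b"
proof -
  define q where "q a = card (underS r a)" for a
  have L: "refl_on (Field r) r" "trans r" "antisym r" "total_on (Field r) r"
    using assms(1) by (auto simp: order_on_defs)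
  have sub: "underS r a \<subseteq> Field r" for a by (auto simp: underS_def Field_def)
  have fin: "finite (underS r a)" for a using sub assms(2) by (rule finite_subset)
  have mono: "q a < q b" if "(a, b) \<in> r" "a \<noteq> b" for a b
  proof -
    have "underS r a \<subseteq> underS r b" using that L(2,3)
      by (auto simp: underS_def dest: transD antisymD)
    moreover have "a \<in> underS r b" "a \<notin> underS r a" using that by (auto simp: underS_def)
    ultimately show ?thesis unfolding q_def using fin by (intro psubset_card_mono) auto
  qed
  have iff: "(a, b) \<in> r \<longleftrightarrow> q a \<le> q b" if "a \<in> Field r" "b \<in> Field r" for a b
    using that mono[of a b] mono[of b a] L(1,4) unfolding refl_on_def total_on_def
    by (cases "a = b") (auto simp: not_le[symmetric])
  have inj: "inj_on q (Field r)"
    using iff L(3) by (intro inj_onI) (metis antisymD order_refl)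
  have "q ` Field r \<subseteq> {..<card (Field r)}"
  proof clarsimp
    fix a assume a: "a \<in> Field r"
    have "a \<notin> underS r a" by (simp add: underS_def)
    then have "underS r a \<subset> Field r" using sub a by blast
    then show "q a < card (Field r)" unfolding q_def by (rule psubset_card_mono[OF assms(2)])
  qed
  moreover have "card (q ` Field r) = card {..<card (Field r)}" using inj by (simp add: card_image)
  ultimately have "q ` Field r = {..<card (Field r)}" by (intro card_subset_eq) auto
  with inj show ?thesis using that iff by (simp add: bij_betw_def)
qed

text \<open>Ranks put \<open>r\<close> on the first positions of the first copy of \<omega>, so
  \<open>r\<close> becomes an initial segment; the elements added around it avoid
  \<open>V\<close>.\<close>

lemma extend_finite_order:
  assumes r: "Linear_order r" "finite (Field r)" and V: "finite V" and k: "0 < k"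
  obtains S :: "nat rel" where "isomorphic S (omega_times k)" "Field r \<subseteq> Field S"
    "Restr S (Field r) = r" "Field S \<inter> V \<subseteq> Field r"
    "\<And>a b. a \<in> Field r \<Longrightarrow> b \<in> Field S - Field r \<Longrightarrow> (a, b) \<in> S"
proof -
  let ?F = "Field r"
  obtain q where q: "bij_betw q ?F {..<card ?F}"
    "\<And>a b. a \<in> ?F \<Longrightarrow> b \<in> ?F \<Longrightarrow> (a, b) \<in> r \<longleftrightarrow> q a \<le> q b"
    using finite_Linear_order_rank[OF r] by blast
  define g where "g a = (0::nat, q a)" for a
  have inf: "infinite (UNIV - (V \<union> ?F))" using V r(2) by (intro Diff_infinite_finite) auto
  have inj: "inj_on g ?F" using q(1) by (auto simp: g_def bij_betw_def inj_on_def)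
  have sub: "g ` ?F \<subseteq> Field (omega_times k)" using k by (auto simp: g_def)
  have dis: "(UNIV - (V \<union> ?F)) \<inter> ?F = {}" by blast
  obtain S f where S: "iso S (omega_times k) f" "?F \<subseteq> Field S"
    "Field S \<subseteq> ?F \<union> (UNIV - (V \<union> ?F))" "\<And>a. a \<in> ?F \<Longrightarrow> f a = g a"
    by (rule extend_embedding[OF inj sub inf dis]) (rule that)
  have f: "bij_betw f (Field S) ({..<k} \<times> UNIV)"
    "\<And>a b. a \<in> Field S \<Longrightarrow> b \<in> Field S \<Longrightarrow> (a, b) \<in> S \<longleftrightarrow> (f a, f b) \<in> omega_times k"
    using S(1) unfolding iso_iff2 by auto
  have "(a, b) \<in> S \<longleftrightarrow> (a, b) \<in> r" if "a \<in> ?F" "b \<in> ?F" for a b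
    using that f(2)[of a b] S(2,4) q(2) k by (auto simp: g_def)
  then have "Restr S ?F = r" by (auto simp: Field_def)
  moreover have "(a, b) \<in> S" if a: "a \<in> ?F" and b: "b \<in> Field S - ?F" for a b
  proof -
    obtain c x where cx: "f b = (c, x)" by fastforce
    have "c < k" using f(1) b cx by (force simp: bij_betw_def)
    \<comment> \<open>A position of the first copy below \<open>q a\<close> is already taken by the
      element of \<open>r\<close> of that rank, so \<open>b\<close> cannot sit there.\<close>
    moreover have "q a \<le> x" if "c = 0"
    proof (rule ccontr)
      assume "\<not> q a \<le> x"
      moreover have "q a < card ?F" using q(1) a by (auto simp: bij_betw_def)
      ultimately have "x \<in> q ` ?F" using q(1) by (auto simp: bij_betw_def)
      then obtain a' where a': "a' \<in> ?F" "q a' = x" by blast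
      then have "f a' = f b" using S(4) cx that by (simp add: g_def)
      then show False using f(1) a' b S(2) by (auto simp: bij_betw_def inj_on_def)
    qed
    ultimately show ?thesis using f(2)[of a b] a b subsetD[OF S(2) a] S(4) cx k by (auto simp: g_def)
  qed
  moreover have "Field S \<inter> V \<subseteq> ?F" using S(3) by blast
  moreover have "isomorphic S (omega_times k)" using S(1) by (auto simp: isomorphic_def)
  ultimately show ?thesis using that S(2) by blast
qed

lemma embeds_imp_suborder:
  assumes inj: "inj_on u (Field K)" and sub: "u ` Field K \<subseteq> Field D"
    and iff: "\<And>p q. p \<in> Field K \<Longrightarrow> q \<in> Field K \<Longrightarrow> (p, q) \<in> K \<longleftrightarrow> (u p, u q) \<in> D"
    and "Linear_order D"
  shows "has_suborder_isomorphic_to D K"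
proof -
  let ?X = "u ` Field K"
  have F: "Field (Restr D ?X) = ?X"
    using Field_Restr_Linear_order[OF assms(4), of ?X] sub by blast
  have "bij_betw (inv_into (Field K) u) ?X (Field K)"
    using inj by (intro bij_betw_inv_into) (simp add: bij_betw_def)
  then have "iso (Restr D ?X) K (inv_into (Field K) u)"
    unfolding iso_iff2 F using inj iff by auto
  then show ?thesis using sub unfolding has_suborder_isomorphic_to_def isomorphic_def by blast
qed

section \<open>The order of two outputs depends only on a finite part\<close>

text \<open>This is what copies of both source orders have in common, so that copies of different
  kinds can be compared with each other.\<close>

definition linear_output :: "(basic set \<times> basic) set \<Rightarrow> nat rel \<Rightarrow> bool" where
  "linear_output \<Gamma> S \<longleftrightarrow> Linear_order S \<and> (\<exists>T. Linear_order T \<and> apply_op \<Gamma> S = diagram T)"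

text \<open>Since \<open>X\<close> is an initial segment of \<open>r2\<close>, putting the rest of
  \<open>r2\<close> on top of \<open>r1\<close> gives a finite order extending both. It sits inside
  a copy of \<open>omega_times k\<close>, whose output contains both comparisons and is
  antisymmetric.\<close>

lemma amalgam_consistent:
  assumes copy: "\<And>S. isomorphic S (omega_times k) \<Longrightarrow> linear_output \<Gamma> S" and k: "0 < k"
    and r1: "Linear_order r1" "finite (Field r1)" "Le x y \<in> apply_op \<Gamma> r1"
    and r2: "Linear_order r2" "finite (Field r2)" "Le y x \<in> apply_op \<Gamma> r2"
    and X: "Field r1 \<inter> Field r2 = X" "Restr r1 X = Restr r2 X"
    and initial: "\<And>a b. a \<in> X \<Longrightarrow> b \<in> Field r2 - X \<Longrightarrow> (a, b) \<in> r2"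
  shows "x = y"
proof -
  define Z where "Z = Field r2 - X"
  define r where "r = r1 \<union> Restr r2 Z \<union> Field r1 \<times> Z"
  have L1: "refl_on (Field r1) r1" "trans r1" "antisym r1" "total_on (Field r1) r1"
    using r1(1) by (auto simp: order_on_defs)
  have L2: "refl_on (Field r2) r2" "trans r2" "antisym r2" "total_on (Field r2) r2"
    using r2(1) by (auto simp: order_on_defs)
  have f1: "a \<in> Field r1 \<and> b \<in> Field r1" if "(a, b) \<in> r1" for a b
    using that by (auto simp: Field_def)
  have f2: "a \<in> Field r2 \<and> b \<in> Field r2" if "(a, b) \<in> r2" for a b
    using that by (auto simp: Field_def)
  have disj: "a \<notin> Field r1" if "a \<in> Z" for a using that X(1) by (auto simp: Z_def)
  have Z2: "Z \<subseteq> Field r2" by (auto simp: Z_def)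
  have F: "Field r = Field r1 \<union> Z"
    using L2(1) Z2 unfolding r_def Field_def refl_on_def by blast
  have "refl_on (Field r) r"
    unfolding F using L1(1) L2(1) Z2 unfolding r_def refl_on_def by blast
  moreover have "trans r"
  proof (rule transI)
    fix a b c assume "(a, b) \<in> r" "(b, c) \<in> r"
    then show "(a, c) \<in> r"
      using L1(2) L2(2) f1[of a b] f1[of b c] disj unfolding r_def trans_def by blast
  qed
  moreover have "antisym r"
    using L1(3) L2(3) f1 disj unfolding r_def antisym_def by blast
  moreover have "total_on (Field r) r"
    unfolding F using L1(4) L2(4) Z2 unfolding r_def total_on_def by blast
  ultimately have r: "Linear_order r" by (auto simp: order_on_defs Field_def)
  have fin: "finite (Field r)" unfolding F using r1(2) r2(2) by (simp add: Z_def)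
  have R1: "Restr r (Field r1) = r1" unfolding r_def using f1 disj by auto
  have "(a, b) \<in> r2 \<longleftrightarrow> (a, b) \<in> r" if "a \<in> Field r2" "b \<in> Field r2" for a b
  proof (cases "a \<in> X"; cases "b \<in> X")
    assume ab: "a \<in> X" "b \<in> X"
    then have "(a, b) \<in> r2 \<longleftrightarrow> (a, b) \<in> r1" using X(2) by blast
    then show ?thesis using ab by (auto simp: r_def Z_def)
  next
    assume ab: "a \<in> X" "b \<notin> X"
    then show ?thesis using initial X(1) that by (auto simp: r_def Z_def)
  next
    assume ab: "a \<notin> X" "b \<in> X"
    then have "(b, a) \<in> r2" using initial that by blast
    then have "(a, b) \<notin> r2" using L2(3) ab by (auto simp: antisym_def)
    moreover have "(a, b) \<notin> r" using ab that f1 X(1) by (auto simp: r_def Z_def)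
    ultimately show ?thesis by simp
  next
    assume ab: "a \<notin> X" "b \<notin> X"
    then show ?thesis using that f1[of a b] X(1) by (auto simp: r_def Z_def)
  qed
  then have R2: "Restr r (Field r2) = r2" using f2 by auto
  obtain S where S: "isomorphic S (omega_times k)" "Restr S (Field r) = r"
    by (rule extend_finite_order[OF r fin finite.emptyI k]) (rule that)
  obtain T where T: "Linear_order T" "apply_op \<Gamma> S = diagram T" and linS: "Linear_order S"
    using copy[OF S(1)] by (auto simp: linear_output_def)
  have rS: "apply_op \<Gamma> r \<subseteq> apply_op \<Gamma> S"
    using apply_op_Restr_mono[OF linS, of \<Gamma> "Field r"] unfolding S(2) .
  have "apply_op \<Gamma> r1 \<subseteq> apply_op \<Gamma> r"
    using apply_op_Restr_mono[OF r, of \<Gamma> "Field r1"] unfolding R1 .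
  moreover have "apply_op \<Gamma> r2 \<subseteq> apply_op \<Gamma> r"
    using apply_op_Restr_mono[OF r, of \<Gamma> "Field r2"] unfolding R2 .
  moreover note rS
  ultimately have "apply_op \<Gamma> r1 \<subseteq> apply_op \<Gamma> S" "apply_op \<Gamma> r2 \<subseteq> apply_op \<Gamma> S"
    by blast+
  then have "Le x y \<in> diagram T" "Le y x \<in> diagram T" using T r1(3) r2(3) by auto
  then show ?thesis using T(1) by (auto simp: order_on_defs antisym_def)
qed

text \<open>
  To compare \<open>S\<close> with \<open>S'\<close>, put a fresh copy of \<open>\<omega> \<cdot> k\<close> on top of the common finite part
  \<open>X\<close>: a finite piece of it can be put on top of any finite piece of \<open>S\<close> or of \<open>S'\<close> alike.
\<close>

lemma output_order_determined:
  assumes eo: "enumeration_operator \<Gamma>"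
    and copy: "\<And>S. isomorphic S (omega_times k) \<Longrightarrow> linear_output \<Gamma> S" and k: "0 < k"
    and lin: "Linear_order S" "Linear_order S'"
    and X: "finite X" "X \<subseteq> Field S" "X \<subseteq> Field S'" "Restr S X = Restr S' X"
    and xy: "Eq x x \<in> apply_op \<Gamma> (Restr S X)" "Eq y y \<in> apply_op \<Gamma> (Restr S X)"
    and le: "Le x y \<in> apply_op \<Gamma> S" "Le y x \<in> apply_op \<Gamma> S'"
  shows "x = y"
proof -
  obtain X1 where X1: "finite X1" "X1 \<subseteq> Field S" "Le x y \<in> apply_op \<Gamma> (Restr S X1)"
    using apply_op_compact[OF le(1) eo lin(1)] by blast
  obtain X2 where X2: "finite X2" "X2 \<subseteq> Field S'" "Le y x \<in> apply_op \<Gamma> (Restr S' X2)"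
    using apply_op_compact[OF le(2) eo lin(2)] by blast
  define V where "V = X1 \<union> X2"
  have linX: "Linear_order (Restr S X)" by (rule Linear_order_Restr[OF lin(1)])
  have FX: "Field (Restr S X) = X"
    using Field_Restr_Linear_order[OF lin(1), of X] X(2) by blast
  have V: "finite V" unfolding V_def using X1(1) X2(1) by simp
  obtain S3 where S3: "isomorphic S3 (omega_times k)" "X \<subseteq> Field S3"
    "Restr S3 X = Restr S X" "Field S3 \<inter> V \<subseteq> X"
    "\<And>a b. a \<in> X \<Longrightarrow> b \<in> Field S3 - X \<Longrightarrow> (a, b) \<in> S3"
    by (rule extend_finite_order[OF linX _ V k, unfolded FX, OF X(1)]) (rule that)
  obtain T where T: "Linear_order T" "apply_op \<Gamma> S3 = diagram T" and lin3: "Linear_order S3"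
    using copy[OF S3(1)] by (auto simp: linear_output_def)
  have "Eq x x \<in> diagram T" "Eq y y \<in> diagram T"
    using xy apply_op_Restr_mono[OF lin3, of \<Gamma> X] unfolding S3(3) T(2) by blast+
  \<comment> \<open>The part \<open>X\<close> alone already outputs \<open>x\<close> and
    \<open>y\<close>, so \<open>S3\<close> has to order them; either answer opposes
    \<open>S'\<close> or \<open>S\<close>.\<close>
  then have cases: "Le x y \<in> apply_op \<Gamma> S3 \<or> Le y x \<in> apply_op \<Gamma> S3"
    using T(1) unfolding T(2) by (cases "x = y") (auto simp: order_on_defs refl_on_def total_on_def)
  \<comment> \<open>Applied to \<open>S'\<close> and to \<open>S\<close> as \<open>U\<close>. The
    supports \<open>Y \<union> X\<close> and \<open>Z \<union> X\<close> meet exactly in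
    \<open>X\<close>, because \<open>S3\<close> avoids \<open>V\<close> outside \<open>X\<close>; on
    the side of \<open>S3\<close> the part \<open>X\<close> is initial, so the two supports
    amalgamate.\<close>
  have cmp: "u = v"
    if uv: "Le u v \<in> apply_op \<Gamma> (Restr U Y)" "Le v u \<in> apply_op \<Gamma> S3"
      and U: "Linear_order U" "X \<subseteq> Field U" "Restr U X = Restr S X"
      and Y: "finite Y" "Y \<subseteq> Field U" "Y \<subseteq> V" for u v U Y
  proof -
    obtain Z where Z: "finite Z" "Z \<subseteq> Field S3" "Le v u \<in> apply_op \<Gamma> (Restr S3 Z)"
      using apply_op_compact[OF uv(2) eo lin3] by blast
    have F1: "Field (Restr U (Y \<union> X)) = Y \<union> X" and F2: "Field (Restr S3 (Z \<union> X)) = Z \<union> X"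
      using Field_Restr_Linear_order[OF U(1), of "Y \<union> X"]
        Field_Restr_Linear_order[OF lin3, of "Z \<union> X"] U(2) Y(2) Z(2) S3(2) by auto
    show ?thesis
    proof (rule amalgam_consistent[OF copy k])
      show "Linear_order (Restr U (Y \<union> X))" "Linear_order (Restr S3 (Z \<union> X))"
        using U(1) lin3 by (simp_all add: Linear_order_Restr)
      show "Le u v \<in> apply_op \<Gamma> (Restr U (Y \<union> X))"
        using uv(1) apply_op_Restr_le[OF U(1), of Y "Y \<union> X" \<Gamma>] by blast
      show "Le v u \<in> apply_op \<Gamma> (Restr S3 (Z \<union> X))"
        using Z(3) apply_op_Restr_le[OF lin3, of Z "Z \<union> X" \<Gamma>] by blast
      show "Field (Restr U (Y \<union> X)) \<inter> Field (Restr S3 (Z \<union> X)) = X"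
        unfolding F1 F2 using S3(4) Y(3) Z(2) by blast
      show "finite (Field (Restr U (Y \<union> X)))" "finite (Field (Restr S3 (Z \<union> X)))"
        unfolding F1 F2 using X(1) Y(1) Z(1) by simp_all
      have "Restr (Restr U (Y \<union> X)) X = Restr U X" "Restr (Restr S3 (Z \<union> X)) X = Restr S3 X"
        by blast+
      then show "Restr (Restr U (Y \<union> X)) X = Restr (Restr S3 (Z \<union> X)) X"
        using U(3) S3(3) by simp
      show "(a, b) \<in> Restr S3 (Z \<union> X)" if "a \<in> X" "b \<in> Field (Restr S3 (Z \<union> X)) - X" for a b
        using S3(5) that Z(2) unfolding F2 by blast
    qed
  qed
  from cases show ?thesis
  proof
    assume "Le x y \<in> apply_op \<Gamma> S3"
    then show ?thesis
      using cmp[OF X2(3) _ lin(2) X(3) X(4)[symmetric] X2(1,2)] by (simp add: V_def)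
  next
    assume "Le y x \<in> apply_op \<Gamma> S3"
    then show ?thesis using cmp[OF X1(3) _ lin(1) X(2) refl X1(1,2)] by (simp add: V_def)
  qed
qed

section \<open>Finite blocks: arranging them, finding them, making them homogeneous\<close>

text \<open>Block \<open>i\<close> fills an interval of length \<open>n i\<close> starting at
  \<open>M i\<close> in copy number \<open>i mod k\<close> of \<open>K\<close>; the unoccupied
  positions are filled from \<open>W\<close>.\<close>

lemma arrange_blocks:
  fixes b :: "nat \<Rightarrow> nat rel"
  assumes lin: "\<And>i. Linear_order (b i)" and fin: "\<And>i. finite (Field (b i))"
    and disj: "\<And>i j. i \<noteq> j \<Longrightarrow> Field (b i) \<inter> Field (b j) = {}"
    and W: "infinite W" "\<And>i. W \<inter> Field (b i) = {}"
    and k: "0 < k" and K: "K = omega_times k \<or> K = omega_star_times k"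
  obtains S where "isomorphic S K" "\<And>i. Field (b i) \<subseteq> Field S"
    "\<And>i. Restr S (Field (b i)) = b i"
    "\<And>i j a a'. i \<noteq> j \<Longrightarrow> ((i mod k, i div k), (j mod k, j div k)) \<in> K \<Longrightarrow>
       a \<in> Field (b i) \<Longrightarrow> a' \<in> Field (b j) \<Longrightarrow> (a, a') \<in> S"
proof -
  define n where "n i = card (Field (b i))" for i
  have "\<exists>q. bij_betw q (Field (b i)) {..<n i} \<and>
      (\<forall>a\<in>Field (b i). \<forall>a'\<in>Field (b i). (a, a') \<in> b i \<longleftrightarrow> q a \<le> q a')" for i
    using finite_Linear_order_rank[OF lin fin, of i] unfolding n_def by metis
  then obtain q where q: "\<And>i. bij_betw (q i) (Field (b i)) {..<n i}"
    "\<And>i a a'. a \<in> Field (b i) \<Longrightarrow> a' \<in> Field (b i) \<Longrightarrow> (a, a') \<in> b i \<longleftrightarrow> q i a \<le> q i a'"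
    by metis
  have qn: "q i a < n i" if "a \<in> Field (b i)" for i a
    using q(1)[of i] that by (auto simp: bij_betw_def)
  have qinj: "a = a'" if "a \<in> Field (b i)" "a' \<in> Field (b i)" "q i a = q i a'" for i a a'
    using q(1)[of i] that by (auto simp: bij_betw_def inj_on_def)
  \<comment> \<open>\<open>p\<close> is the place within the block and \<open>m\<close> an arbitrary
    offset, later \<open>M i\<close>. For \<open>omega_star_times k\<close> the rank is reversed, as
    larger second coordinates come lower there.\<close>
  have "\<exists>p. (\<forall>i. \<forall>a\<in>Field (b i). p i a < n i \<and> (\<forall>a'\<in>Field (b i). (p i a = p i a' \<longrightarrow> a = a') \<and>
      (\<forall>c<k. \<forall>m. (a, a') \<in> b i \<longleftrightarrow> ((c, m + p i a), (c, m + p i a')) \<in> K)))"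
    using K
  proof
    assume "K = omega_times k"
    then show ?thesis using qn qinj q(2) by (intro exI[of _ q]) auto
  next
    assume Ks: "K = omega_star_times k"
    have "n i - 1 - q i a < n i" "n i - 1 - q i a = n i - 1 - q i a' \<longleftrightarrow> q i a = q i a'"
      "n i - 1 - q i a' \<le> n i - 1 - q i a \<longleftrightarrow> q i a \<le> q i a'"
      if "a \<in> Field (b i)" "a' \<in> Field (b i)" for i a a'
      using qn[OF that(1)] qn[OF that(2)] by linarith+
    then show ?thesis
      using qinj q(2) by (intro exI[of _ "\<lambda>i a. n i - 1 - q i a"]) (simp add: Ks)
  qed
  then obtain p where p: "\<And>i a. a \<in> Field (b i) \<Longrightarrow> p i a < n i"
    "\<And>i a a'. a \<in> Field (b i) \<Longrightarrow> a' \<in> Field (b i) \<Longrightarrow> p i a = p i a' \<Longrightarrow> a = a'"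
    "\<And>i a a' c m. a \<in> Field (b i) \<Longrightarrow> a' \<in> Field (b i) \<Longrightarrow> c < k \<Longrightarrow>
      (a, a') \<in> b i \<longleftrightarrow> ((c, m + p i a), (c, m + p i a')) \<in> K"
    by blast
  \<comment> \<open>The sum runs over all earlier blocks, also those lying in other copies. This
    leaves gaps, but makes the intervals disjoint and increasing with \<open>i\<close>
    uniformly.\<close>
  define M where "M i = (\<Sum>j<i. n j)" for i
  have M: "M i + n i \<le> M j" if "i < j" for i j
  proof -
    have "M i + n i = M (Suc i)" by (simp add: M_def)
    also have "\<dots> \<le> M j" unfolding M_def using that by (intro sum_mono2) auto
    finally show ?thesis .
  qed
  define Y where "Y = (\<Union>i. Field (b i))"
  define blk where "blk a = (THE i. a \<in> Field (b i))" for a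
  have blk: "blk a = i" if "a \<in> Field (b i)" for a i
    unfolding blk_def using that disj by (intro the_equality) blast+
  define g where "g a = (blk a mod k, M (blk a) + p (blk a) a)" for a
  have less: "M i + p i a < M j + p j a'" if "i < j" "a \<in> Field (b i)" for i j a a'
    using M[OF that(1)] p(1)[OF that(2)] by linarith
  have inj: "inj_on g Y"
  proof (rule inj_onI)
    fix a a' assume "a \<in> Y" "a' \<in> Y" and eq: "g a = g a'"
    then obtain i j where ij: "a \<in> Field (b i)" "a' \<in> Field (b j)" by (auto simp: Y_def)
    have "i = j" using eq less[of i j a a'] less[of j i a' a] ij blk
      by (cases i j rule: linorder_cases) (auto simp: g_def)
    then show "a = a'" using eq ij blk p(2) by (auto simp: g_def)
  qed
  have "g ` Y \<subseteq> Field K" using K k by (auto simp: g_def)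
  moreover have "W \<inter> Y = {}" using W(2) by (auto simp: Y_def)
  ultimately obtain S f where S: "iso S K f" "Y \<subseteq> Field S" "\<And>a. a \<in> Y \<Longrightarrow> f a = g a"
    by (rule extend_embedding[OF inj _ W(1)]) (rule that)
  have SK: "(a, a') \<in> S \<longleftrightarrow> (g a, g a') \<in> K" if "a \<in> Y" "a' \<in> Y" for a a'
    using S that unfolding iso_iff2 by (metis subsetD)
  have bY: "Field (b i) \<subseteq> Y" for i by (auto simp: Y_def)
  have in_block: "(a, a') \<in> S \<longleftrightarrow> (a, a') \<in> b i" if "a \<in> Field (b i)" "a' \<in> Field (b i)" for i a a'
    using SK[of a a'] bY[of i] that blk p(3)[of a i a' "i mod k" "M i"] k by (auto simp: g_def)
  have "Restr S (Field (b i)) = b i" for i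
    using in_block[where i = i] by (auto intro: FieldI1 FieldI2)
  moreover have "(a, a') \<in> S" if "i \<noteq> j" and enc: "((i mod k, i div k), (j mod k, j div k)) \<in> K"
    and a: "a \<in> Field (b i)" "a' \<in> Field (b j)" for i j a a'
  proof -
    \<comment> \<open>Within one residue class the order of quotients is the order of indices, so
      \<open>less\<close> decides the positions.\<close>
    have le: "i' div k \<le> j' div k \<longleftrightarrow> i' \<le> j'" if "i' mod k = j' mod k" for i' j'
      using that by (metis add_le_cancel_right div_le_mono div_mult_mod_eq mult_le_mono1)
    have "(g a, g a') \<in> K"
    proof (cases "i mod k = j mod k")
      case True
      then show ?thesis
        using K enc a blk less[of i j a a'] less[of j i a' a] k le[of i j] le[of j i] \<open>i \<noteq> j\<close>
        by (auto simp: g_def)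
    next
      case False
      then show ?thesis using K enc a blk by (auto simp: g_def)
    qed
    then show ?thesis using SK a bY by blast
  qed
  moreover have "isomorphic S K" using S(1) by (auto simp: isomorphic_def)
  ultimately show ?thesis using that[of S] S(2) bY by blast
qed

text \<open>Take copies with pairwise disjoint domains. Each has infinitely many outputs, so a new
  output can be chosen from each in turn, and compactness cuts the copy down to a finite block
  producing it.\<close>

lemma disjoint_productive_blocks:
  assumes eo: "enumeration_operator \<Gamma>" and k: "0 < k"
    and copy: "\<And>S. isomorphic S (omega_star_times k) \<Longrightarrow>
      Linear_order S \<and> infinite {z. Eq z z \<in> apply_op \<Gamma> S}"
  obtains b :: "nat \<Rightarrow> nat rel" and z W where
    "\<And>i. Linear_order (b i)" "\<And>i. finite (Field (b i))"
    "\<And>i j. i \<noteq> j \<Longrightarrow> Field (b i) \<inter> Field (b j) = {}"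
    "infinite W" "\<And>i. W \<inter> Field (b i) = {}"
    "inj z" "\<And>i. Eq (z i) (z i) \<in> apply_op \<Gamma> (b i)"
proof -
  \<comment> \<open>Infinitely many disjoint infinite columns: \<open>N 0\<close> is kept as the
    reserve \<open>W\<close>, and \<open>N (Suc i)\<close> hosts the copy
    \<open>S i\<close>.\<close>
  define N where "N i = range (\<lambda>n. prod_encode (i, n))" for i
  have N: "infinite (N i)" for i
    unfolding N_def by (rule range_inj_infinite) (auto simp: inj_def)
  have Ndisj: "N i \<inter> N j = {}" if "i \<noteq> j" for i j using that by (auto simp: N_def)
  have "\<exists>S. isomorphic S (omega_star_times k) \<and> Field S \<subseteq> N (Suc i)" for i
  proof -
    obtain S f where "iso S (omega_star_times k) f" "Field S \<subseteq> {} \<union> N (Suc i)"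
      by (rule extend_embedding[of "\<lambda>a. (0, a)" "{}" "omega_star_times k" "N (Suc i)"])
        (use N in auto)
    then show ?thesis by (auto simp: isomorphic_def)
  qed
  then obtain S where S: "\<And>i. isomorphic (S i) (omega_star_times k)" "\<And>i. Field (S i) \<subseteq> N (Suc i)"
    by metis
  have lin: "Linear_order (S i)" and inf: "infinite {z. Eq z z \<in> apply_op \<Gamma> (S i)}" for i
    using copy[OF S(1)] by auto
  have "\<exists>z. \<forall>i. Eq (z i) (z i) \<in> apply_op \<Gamma> (S i) \<and> z i < z (Suc i)"
  proof (rule dependent_nat_choice)
    show "\<exists>x. Eq x x \<in> apply_op \<Gamma> (S 0)" using infinite_imp_nonempty[OF inf[of 0]] by auto
    show "\<exists>y. Eq y y \<in> apply_op \<Gamma> (S (Suc i)) \<and> x < y" for x i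
      using inf[of "Suc i"] unfolding infinite_nat_iff_unbounded by blast
  qed
  then obtain z where z: "\<And>i. Eq (z i) (z i) \<in> apply_op \<Gamma> (S i)" "\<And>i. z i < z (Suc i)" by blast
  have "\<exists>X. finite X \<and> X \<subseteq> Field (S i) \<and> Eq (z i) (z i) \<in> apply_op \<Gamma> (Restr (S i) X)" for i
    using apply_op_compact[OF z(1) eo lin, of i] by metis
  then obtain X where X: "\<And>i. finite (X i)" "\<And>i. X i \<subseteq> Field (S i)"
    "\<And>i. Eq (z i) (z i) \<in> apply_op \<Gamma> (Restr (S i) (X i))" by metis
  define b where "b i = Restr (S i) (X i)" for i
  have F: "Field (b i) = X i" for i
    using Field_Restr_Linear_order[OF lin, of i "X i"] X(2) by (auto simp: b_def)
  have XN: "X i \<subseteq> N (Suc i)" for i using X(2) S(2) by blast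
  show ?thesis
  proof (rule that[of b "N 0" z])
    show "Linear_order (b i)" for i unfolding b_def by (rule Linear_order_Restr[OF lin])
    show "finite (Field (b i))" for i unfolding F by (rule X(1))
    show "Field (b i) \<inter> Field (b j) = {}" if "i \<noteq> j" for i j
      unfolding F using XN[of i] XN[of j] Ndisj[of "Suc i" "Suc j"] that by auto
    show "infinite (N 0)" by (rule N)
    show "N 0 \<inter> Field (b i) = {}" for i unfolding F using XN[of i] Ndisj[of 0 "Suc i"] by auto
    show "inj z" using z(2) by (intro strict_mono_imp_inj_on) (simp add: strict_mono_Suc_iff)
    show "Eq (z i) (z i) \<in> apply_op \<Gamma> (b i)" for i unfolding b_def by (rule X(3))
  qed
qed

text \<open>Ramsey's theorem for unordered pairs with four colours: the colour records the truth
  values of \<open>C\<close> in both directions as two binary digits, with \<open>Min\<close> and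
  \<open>Max\<close> restoring the orientation.\<close>

lemma homogeneous_subsequence:
  fixes C :: "nat \<Rightarrow> nat \<Rightarrow> bool"
  obtains e :: "nat \<Rightarrow> nat" and c c' where "strict_mono e"
    "\<And>i j. i < j \<Longrightarrow> C (e i) (e j) = c" "\<And>i j. i < j \<Longrightarrow> C (e j) (e i) = c'"
proof -
  define col where "col V = (if C (Min V) (Max V) then 1 else 0) +
    (if C (Max V) (Min V) then 2 else (0::nat))" for V
  have col: "col {i, j} = (if C i j then 1 else 0) + (if C j i then 2 else 0)" if "i < j" for i j
    using that by (simp add: col_def)
  have "\<exists>Y t. Y \<subseteq> (UNIV :: nat set) \<and> infinite Y \<and> t < 4 \<and>
      (\<forall>x\<in>Y. \<forall>y\<in>Y. x \<noteq> y \<longrightarrow> col {x, y} = t)"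
    by (rule Ramsey2) (auto simp: col_def)
  then obtain Y t where Y: "infinite Y" and t: "\<forall>x\<in>Y. \<forall>y\<in>Y. x \<noteq> y \<longrightarrow> col {x, y} = t"
    by blast
  define e where "e = enumerate Y"
  have e: "strict_mono e" unfolding e_def by (rule strict_mono_enumerate[OF Y])
  have eY: "e i \<in> Y" for i unfolding e_def by (rule enumerate_in_set[OF Y])
  have "(if C (e i) (e j) then 1 else 0) + (if C (e j) (e i) then 2 else 0) = t" if "i < j" for i j
  proof -
    have "e i < e j" using e that by (rule strict_monoD)
    then show ?thesis using t eY[of i] eY[of j] col[of "e i" "e j"] by auto
  qed
  then have "C (e i) (e j) = (t = 1 \<or> t = 3)" "C (e j) (e i) = (t = 2 \<or> t = 3)" if "i < j" for i j
    using that by (cases "C (e i) (e j)"; cases "C (e j) (e i)"; force)+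
  then show ?thesis using that e by blast
qed

section \<open>Embedding both source orders into their targets\<close>

theorem theorem5p10:
  fixes k :: nat and \<Gamma> :: "(basic set \<times> basic) set" and D0 D1 :: "nat rel"
  assumes "k \<ge> 2"
    and "Linear_order D0" and "\<not> has_infinite_descending_chain D0"
    and "Linear_order D1" and "infinite (Field D1)" and "\<not> has_infinite_ascending_chain D1"
    and "witnesses_embedding \<Gamma> (omega_times k) (omega_star_times k) D0 D1"
  shows "has_suborder_isomorphic_to D0 (omega_times k) \<and>
         has_suborder_isomorphic_to D1 (omega_star_times k)"
proof -
  let ?A = "omega_times k" and ?B = "omega_star_times k"
  have k: "0 < k" using assms(1) by simp
  have eo: "enumeration_operator \<Gamma>" using assms(7) by (simp add: witnesses_embedding_def)
  \<comment> \<open>Ties each source to its target, so that the arguments common to both sides are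
    given once.\<close>
  define pair where "pair K D \<longleftrightarrow> K = ?A \<and> D = D0 \<or> K = ?B \<and> D = D1" for K and D :: "nat rel"
  have pairs: "pair ?A D0" "pair ?B D1" by (auto simp: pair_def)
  have linK: "Linear_order K" and linD: "Linear_order D" if "pair K D" for K D
    using that assms(2,4) Linear_order_omega_times[of k] Linear_order_omega_star_times[of k]
    unfolding pair_def by blast+
  have FK: "Field K = {..<k} \<times> UNIV" if "pair K D" for K D
    using that by (auto simp: pair_def)
  have copy: "\<exists>T f. iso T D f \<and> Linear_order T \<and> apply_op \<Gamma> S = diagram T"
    if KD: "pair K D" and S: "isomorphic S K" for K D S
  proof -
    obtain T where T: "isomorphic T D" "apply_op \<Gamma> S = diagram T"
      using KD S assms(7) unfolding pair_def witnesses_embedding_def by blast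
    then show ?thesis
      using Linear_order_isomorphic[OF T(1) linD[OF KD]] by (auto simp: isomorphic_def)
  qed
  have output_ok: "linear_output \<Gamma> S" if "pair K D" "isomorphic S K" for K D S
    using copy[OF that] Linear_order_isomorphic[OF that(2) linK[OF that(1)]]
    by (auto simp: linear_output_def)
  have prod: "Linear_order S \<and> infinite {z. Eq z z \<in> apply_op \<Gamma> S}" if S: "isomorphic S ?B" for S
  proof -
    obtain T f where T: "iso T D1 f" "apply_op \<Gamma> S = diagram T" using copy[OF pairs(2) S] by blast
    have "{z. Eq z z \<in> apply_op \<Gamma> S} = Field T" by (simp add: T(2))
    moreover have "infinite (Field T)"
      using assms(5) T(1) by (auto simp: iso_def bij_betw_finite)
    ultimately show ?thesis using output_ok[OF pairs(2) S] by (simp add: linear_output_def)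
  qed
  obtain b :: "nat \<Rightarrow> nat rel" and z W where lin: "\<And>i. Linear_order (b i)" and fin: "\<And>i. finite (Field (b i))"
    and disj: "\<And>i j. i \<noteq> j \<Longrightarrow> Field (b i) \<inter> Field (b j) = {}"
    and W: "infinite W" "\<And>i. W \<inter> Field (b i) = {}"
    and z: "inj z" "\<And>i. Eq (z i) (z i) \<in> apply_op \<Gamma> (b i)"
    by (rule disjoint_productive_blocks[OF eo k prod]) (assumption, rule that)
  \<comment> \<open>\<open>P S i j\<close>: the blocks \<open>b i\<close> and \<open>b j\<close> occur in \<open>S\<close> in this order. By \<open>C_iff\<close> below,
    \<open>C i j\<close> is independent of the choice of \<open>S\<close>.\<close>
  define P where "P S i j \<longleftrightarrow> linear_output \<Gamma> S \<and> Field (b i) \<subseteq> Field S \<and> Field (b j) \<subseteq> Field S \<and>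
    Restr S (Field (b i)) = b i \<and> Restr S (Field (b j)) = b j \<and>
    (\<forall>a\<in>Field (b i). \<forall>a'\<in>Field (b j). (a, a') \<in> S)" for S i j
  define C where "C i j \<longleftrightarrow> (\<exists>S. P S i j \<and> Le (z i) (z j) \<in> apply_op \<Gamma> S)" for i j
  \<comment> \<open>The right-hand side is the ordered sum of the two blocks and does not mention
    \<open>S\<close>. It is the common finite part needed to apply
    \<open>output_order_determined\<close>.\<close>
  have P_Restr: "Restr S (Field (b i) \<union> Field (b j)) =
      b i \<union> b j \<union> Field (b i) \<times> Field (b j)" if P: "P S i j" and "i \<noteq> j" for S i j
  proof -
    have bi: "Restr S (Field (b i)) = b i" and bj: "Restr S (Field (b j)) = b j"
      and ij: "\<And>a a'. a \<in> Field (b i) \<Longrightarrow> a' \<in> Field (b j) \<Longrightarrow> (a, a') \<in> S"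
      using P unfolding P_def by blast+
    have anti: "antisym S" using P by (simp add: P_def linear_output_def order_on_defs)
    have ji: "(a', a) \<notin> S" if a: "a \<in> Field (b i)" "a' \<in> Field (b j)" for a a'
    proof
      assume "(a', a) \<in> S"
      then have "a = a'" by (rule antisymD[OF anti ij[OF a]])
      then show False using disj[OF \<open>i \<noteq> j\<close>] a by blast
    qed
    have "Restr S (Field (b i) \<union> Field (b j)) =
        Restr S (Field (b i)) \<union> Restr S (Field (b j)) \<union> Field (b i) \<times> Field (b j)"
      using ij ji by blast
    then show ?thesis unfolding bi bj .
  qed
  have C_iff: "Le (z i) (z j) \<in> apply_op \<Gamma> S \<longleftrightarrow> C i j" if S: "P S i j" and "i \<noteq> j" for S i j
  proof
    assume "C i j"
    then obtain S' where S': "P S' i j" "Le (z i) (z j) \<in> apply_op \<Gamma> S'" by (auto simp: C_def)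
    obtain T where T: "Linear_order T" "apply_op \<Gamma> S = diagram T" and linS: "Linear_order S"
      using S by (auto simp: P_def linear_output_def)
    have linS': "Linear_order S'" using S'(1) by (simp add: P_def linear_output_def)
    let ?X = "Field (b i) \<union> Field (b j)"
    have "b i = Restr S' (Field (b i))" "b j = Restr S' (Field (b j))"
      using S'(1) by (auto simp: P_def)
    then have zX: "Eq (z i) (z i) \<in> apply_op \<Gamma> (Restr S' ?X)" "Eq (z j) (z j) \<in> apply_op \<Gamma> (Restr S' ?X)"
      using z(2)[of i] z(2)[of j] apply_op_Restr_le[OF linS', of "Field (b i)" ?X \<Gamma>]
        apply_op_Restr_le[OF linS', of "Field (b j)" ?X \<Gamma>] by auto
    have eq: "Restr S' ?X = Restr S ?X" using P_Restr S S'(1) \<open>i \<noteq> j\<close> by simp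
    show "Le (z i) (z j) \<in> apply_op \<Gamma> S"
    proof (rule ccontr)
      assume not: "Le (z i) (z j) \<notin> apply_op \<Gamma> S"
      \<comment> \<open>Both elements are output by \<open>S\<close> as well, so totality gives the
        reverse comparison, contrary to that of \<open>S'\<close> over the same finite part.\<close>
      have "Eq (z i) (z i) \<in> apply_op \<Gamma> S" "Eq (z j) (z j) \<in> apply_op \<Gamma> S"
        using zX apply_op_Restr_mono[OF linS] unfolding eq by blast+
      then have "Le (z j) (z i) \<in> apply_op \<Gamma> S"
        using not T by (cases "z i = z j") (auto simp: order_on_defs refl_on_def total_on_def)
      then have "z i = z j"
        using S S'(1)
          by (intro output_order_determined[OF eo output_ok[OF pairs(1)] k linS' linS _ _ _ eq zX S'(2)])
            (auto simp: P_def fin)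
      then show False using z(1) \<open>i \<noteq> j\<close> by (auto simp: inj_def)
    qed
  qed (use S in \<open>auto simp: C_def\<close>)
  obtain e :: "nat \<Rightarrow> nat" and c c' where e: "strict_mono e"
    and c: "\<And>i j. i < j \<Longrightarrow> C (e i) (e j) = c" "\<And>i j. i < j \<Longrightarrow> C (e j) (e i) = c'"
    using homogeneous_subsequence[of C] by blast
  have einj: "e i = e j \<longleftrightarrow> i = j" for i j using e by (simp add: strict_mono_eq)
  \<comment> \<open>Index \<open>x * k + r\<close> is sent to position \<open>x\<close> of the \<open>r\<close>-th copy, so the multiples of \<open>k\<close> fill the
    first copy.\<close>
  define enc where "enc i = (i mod k, i div k)" for i
  have enc: "enc (x * k + r) = (r, x)" if "r < k" for x r using that by (simp add: enc_def)
  \<comment> \<open>\<open>w i\<close> is the output of the block \<open>b (e i)\<close>, carried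
    into \<open>D\<close> by the isomorphism, when the blocks are arranged in type \<open>K\<close>.
    The equivalence speaks only of pairs whose first block comes first in \<open>K\<close>.\<close>
  have outputs: "\<exists>w. range w \<subseteq> Field D \<and> inj w \<and>
      (\<forall>i j. i \<noteq> j \<longrightarrow> (enc i, enc j) \<in> K \<longrightarrow> ((w i, w j) \<in> D \<longleftrightarrow> C (e i) (e j)))"
    if KD: "pair K D" for K D
  proof -
    have KAB: "K = ?A \<or> K = ?B" using KD by (auto simp: pair_def)
    have disj': "Field (b (e i)) \<inter> Field (b (e j)) = {}" if "i \<noteq> j" for i j
      using disj einj that by blast
    obtain S where S: "isomorphic S K" "\<And>i. Field (b (e i)) \<subseteq> Field S"
      "\<And>i. Restr S (Field (b (e i))) = b (e i)"
      "\<And>i j a a'. i \<noteq> j \<Longrightarrow> (enc i, enc j) \<in> K \<Longrightarrow>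
         a \<in> Field (b (e i)) \<Longrightarrow> a' \<in> Field (b (e j)) \<Longrightarrow> (a, a') \<in> S"
      by (rule arrange_blocks[of "\<lambda>i. b (e i)", OF lin fin disj' W k KAB, folded enc_def])
        (assumption, rule that)
    obtain T f where T: "iso T D f" "Linear_order T" "apply_op \<Gamma> S = diagram T"
      using copy[OF KD S(1)] by blast
    have outS: "linear_output \<Gamma> S" by (rule output_ok[OF KD S(1)])
    then have linS: "Linear_order S" by (simp add: linear_output_def)
    have "Eq (z (e i)) (z (e i)) \<in> apply_op \<Gamma> S" for i
      using z(2)[of "e i"] apply_op_Restr_mono[OF linS, of \<Gamma> "Field (b (e i))"] unfolding S(3) by blast
    then have zT: "z (e i) \<in> Field T" for i by (simp add: T(3))
    have f: "bij_betw f (Field T) (Field D)"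
      "\<And>x y. x \<in> Field T \<Longrightarrow> y \<in> Field T \<Longrightarrow> (x, y) \<in> T \<longleftrightarrow> (f x, f y) \<in> D"
      using T(1) unfolding iso_iff2 by auto
    have "range (\<lambda>i. f (z (e i))) \<subseteq> Field D" using f(1) zT by (auto simp: bij_betw_def)
    moreover have "inj (\<lambda>i. f (z (e i)))"
    proof (rule injI)
      fix i j assume "f (z (e i)) = f (z (e j))"
      then have "z (e i) = z (e j)" using f(1) zT by (auto simp: bij_betw_def dest: inj_onD)
      then show "i = j" using z(1) einj by (simp add: inj_eq)
    qed
    moreover have "(f (z (e i)), f (z (e j))) \<in> D \<longleftrightarrow> C (e i) (e j)"
      if "i \<noteq> j" "(enc i, enc j) \<in> K" for i j
    proof -
      have "P S (e i) (e j)" unfolding P_def using outS S(2,3) S(4)[OF that] by simp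
      then have "Le (z (e i)) (z (e j)) \<in> apply_op \<Gamma> S \<longleftrightarrow> C (e i) (e j)"
        by (rule C_iff) (simp add: einj that)
      then show ?thesis using zT f(2) by (simp add: T(3))
    qed
    ultimately show ?thesis by (intro exI[of _ "\<lambda>i. f (z (e i))"]) blast
  qed
  have enck: "enc (i * k) = (0, i)" for i using k by (simp add: enc_def)
  have rev: "(y, x) \<in> D" if "pair K D" "x \<in> Field D" "y \<in> Field D" "(x, y) \<notin> D" for K D x y
    using linD[OF that(1)] that(2-4)
    by (cases "x = y") (auto simp: order_on_defs refl_on_def total_on_def)
  \<comment> \<open>In type \<open>omega_times k\<close> the blocks indexed by multiples of
    \<open>k\<close> form an increasing \<omega>-sequence; if \<open>c\<close> were false, their
    outputs would descend in \<open>D0\<close>.\<close>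
  have c
  proof (rule ccontr)
    assume "\<not> c"
    obtain w where w: "range w \<subseteq> Field D0" "inj w"
      "\<And>i j. i \<noteq> j \<Longrightarrow> (enc i, enc j) \<in> ?A \<Longrightarrow> (w i, w j) \<in> D0 \<longleftrightarrow> C (e i) (e j)"
      using outputs[OF pairs(1)] by blast
    have "(w (Suc i * k), w (i * k)) \<in> D0 \<and> w (Suc i * k) \<noteq> w (i * k)" for i
    proof -
      have lt: "i * k < Suc i * k" using k by simp
      have "(enc (i * k), enc (Suc i * k)) \<in> ?A" unfolding enck using k by simp
      then have "(w (i * k), w (Suc i * k)) \<notin> D0"
        using w(3) lt c(1)[OF lt] \<open>\<not> c\<close> by simp
      then have "(w (Suc i * k), w (i * k)) \<in> D0" using w(1) by (intro rev[OF pairs(1)]) auto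
      then show ?thesis using inj_eq[OF w(2)] lt by (metis less_irrefl)
    qed
    then have "has_infinite_descending_chain D0"
      unfolding has_infinite_descending_chain_def by (intro exI[of _ "\<lambda>i. w (i * k)"]) blast
    then show False using assms(3) by contradiction
  qed
  \<comment> \<open>In type \<open>omega_star_times k\<close> the block of larger index comes first
    within a copy, so \<open>c'\<close> governs; if it were false, the outputs would ascend in
    \<open>D1\<close> as the index grows.\<close>
  have c'
  proof (rule ccontr)
    assume "\<not> c'"
    obtain w where w: "range w \<subseteq> Field D1" "inj w"
      "\<And>i j. i \<noteq> j \<Longrightarrow> (enc i, enc j) \<in> ?B \<Longrightarrow> (w i, w j) \<in> D1 \<longleftrightarrow> C (e i) (e j)"
      using outputs[OF pairs(2)] by blast
    have "(w (i * k), w (Suc i * k)) \<in> D1 \<and> w (i * k) \<noteq> w (Suc i * k)" for i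
    proof -
      have lt: "i * k < Suc i * k" using k by simp
      have "(enc (Suc i * k), enc (i * k)) \<in> ?B" unfolding enck using k by simp
      then have "(w (Suc i * k), w (i * k)) \<notin> D1"
        using w(3) lt c(2)[OF lt] \<open>\<not> c'\<close> by simp
      then have "(w (i * k), w (Suc i * k)) \<in> D1" using w(1) by (intro rev[OF pairs(2)]) auto
      then show ?thesis using inj_eq[OF w(2)] lt by (metis less_irrefl)
    qed
    then have "has_infinite_ascending_chain D1"
      unfolding has_infinite_ascending_chain_def by (intro exI[of _ "\<lambda>i. w (i * k)"]) blast
    then show False using assms(6) by contradiction
  qed
  \<comment> \<open>Whatever the two indices, the block placed earlier now outputs the smaller
    element, in both arrangements.\<close>
  have C: "C (e i) (e j)" if "i \<noteq> j" for i j
    using that c \<open>c\<close> \<open>c'\<close> by (cases i j rule: linorder_cases) auto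
  have "has_suborder_isomorphic_to D K" if KD: "pair K D" for K D
  proof -
    obtain w where w: "range w \<subseteq> Field D" "inj w"
      "\<And>i j. i \<noteq> j \<Longrightarrow> (enc i, enc j) \<in> K \<Longrightarrow> (w i, w j) \<in> D"
      using outputs[OF KD] C by blast
    \<comment> \<open>The index \<open>x * k + r\<close> inverts \<open>enc\<close>: position
      \<open>x\<close> of copy \<open>r\<close> goes to the output of the block placed
      there.\<close>
    define u where "u = (\<lambda>(r, x). w (x * k + r))"
    have inj: "inj_on u (Field K)"
    proof (rule inj_onI)
      fix p q assume pq: "p \<in> Field K" "q \<in> Field K" "u p = u q"
      obtain r x r' x' where rx: "p = (r, x)" "q = (r', x')" by fastforce
      have "r < k" "r' < k" using pq(1,2) by (simp_all add: rx FK[OF KD])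
      then have "p = enc (x * k + r)" "q = enc (x' * k + r')" using enc rx by simp_all
      moreover have "w (x * k + r) = w (x' * k + r')" using pq(3) by (simp add: u_def rx)
      ultimately show "p = q" using injD[OF w(2)] by metis
    qed
    have fwd: "(u p, u q) \<in> D" if pq: "p \<in> Field K" "q \<in> Field K" "(p, q) \<in> K" "p \<noteq> q" for p q
    proof -
      obtain r x r' x' where rx: "p = (r, x)" "q = (r', x')" by fastforce
      have "r < k" "r' < k" using pq(1,2) by (simp_all add: rx FK[OF KD])
      then have "enc (x * k + r) = p" "enc (x' * k + r') = q" using enc rx by simp_all
      moreover from this have "x * k + r \<noteq> x' * k + r'" using pq(4) by auto
      ultimately show ?thesis using w(3) pq(3) by (simp add: u_def rx)
    qed
    show ?thesis
    proof (rule embeds_imp_suborder[OF inj _ _ linD[OF KD]])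
      show "u ` Field K \<subseteq> Field D" using w(1) by (auto simp: u_def)
      fix p q assume pq: "p \<in> Field K" "q \<in> Field K"
      show "(p, q) \<in> K \<longleftrightarrow> (u p, u q) \<in> D"
      proof (cases "p = q")
        case True
        then show ?thesis
          using pq linK[OF KD] linD[OF KD] \<open>u ` Field K \<subseteq> Field D\<close>
          by (auto simp: order_on_defs refl_on_def)
      next
        case False
        \<comment> \<open>If \<open>(p, q)\<close> is not in \<open>K\<close>, totality of
          \<open>K\<close> and \<open>fwd\<close> give \<open>(u q, u p)\<close> in
          \<open>D\<close>; antisymmetry of \<open>D\<close> then excludes
          \<open>(u p, u q)\<close>.\<close>
        then have "u p \<noteq> u q" using inj pq by (auto dest: inj_onD)
        moreover have "(p, q) \<in> K \<or> (q, p) \<in> K"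
          using linK[OF KD] pq False by (auto simp: order_on_defs total_on_def)
        moreover have "antisym D" using linD[OF KD] by (simp add: order_on_defs)
        ultimately show ?thesis using fwd pq False unfolding antisym_def by metis
      qed
    qed
  qed
  then show ?thesis using pairs by blast
qed

end
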